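(* There exists a shipment policy $\pi^*=(\bar\tau,f_0,f_1,\dots,f_{\bar\tau})\in\Pi$ that maximizes the expected profit $\mathbb{E}[G^\pi]$ over all $\pi\in\Pi$ and has monotonically increasing fees, i.e. $f_\tau\ge f_{\tau-1}$ for all $\tau\in\{1,2,\dots,\bar\tau\}$.
   Context: Model. Fix $T\in\mathbb{N}$, $T\ge 1$, $\lambda>0$, $\beta>0$, reals $0\le U_{\min}<U_{\max}<\infty$, and a discrete random variable $K$ with support $\mathbb{N}_0$ such that $\rho=\lambda/\mathbb{E}[K]<1$. Put $w(f)=\frac{U_{\max}-f}{U_{\max}-U_{\min}}$ for $f\in[U_{\min},U_{\max}]$. Policies. A shipment policy is $\pi=(\bar\tau,f_0,\dots,f_{\bar\tau})$ with cutoff point $\bar\tau\in\{0,\dots,T-1\}$ and fees $f_\tau\in[U_{\min},U_{\max}]$ for $\tau=0,\dots,\bar\tau$; $\Pi$ is the set of all of them. Dynamics under $\pi$. Time is $t\in\mathbb{N}_0$; the age is $\tau=t \bmod T$; cycle $l$ is $\{lT,\dots,lT+T-1\}$. For each $t$ with age $\tau$: if $\tau\le\bar\tau$, $E_t\sim\mathrm{Poi}(w(f_\tau)\lambda)$ and $N_t\sim\mathrm{Poi}((1-w(f_\tau))\lambda)$; if $\tau>\bar\tau$, $E_t=0$ and $N_t\sim\mathrm{Poi}(\lambda)$. Let $D_t=E_t+N_t$, and $K_t\sim K$. All $E_t,N_t,K_t$, $t\in\mathbb{N}_0$, are independent. The backlogs evolve by $X^\Sigma_{t+1}=(X^\Sigma_t+D_t-K_t)^+$,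 and $X^h_{t+1}=(X^h_t+E_t-K_t)^+$ if $t\bmod T\ne T-1$, $X^h_{t+1}=(X^\Sigma_t+D_t-K_t)^+$ if $t\bmod T=T-1$, where $x^+=\max(x,0)$, from a fixed deterministic initial state with $X^h_0\le X^\Sigma_0$. Performance. The backorders of cycle $l$ are $B_l=(X^h_{lT+T-1}+E_{lT+T-1}-K_{lT+T-1})^+$, and $\mathbb{E}[B^\pi]=\lim_{L\to\infty}\frac1L\sum_{l=0}^{L-1}\mathbb{E}[B_l]$ (long-run average; it does not depend on the initial state). The expected revenue is $\mathbb{E}[R^\pi]=\lambda\sum_{\tau=0}^{\bar\tau}f_\tau w(f_\tau)$ and the expected profit is $\mathbb{E}[G^\pi]=\mathbb{E}[R^\pi]-\beta\,\mathbb{E}[B^\pi]$. *)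

theory Defs
  imports "HOL-Probability.Probability"
begin

text \<open>
  The pair \<open>(c, f)\<close> stands for the tuple with cutoff point \<open>c\<close> and fees \<open>f 0, \<dots>, f c\<close>; using
  extensional functions, different pairs in \<open>policies\<close> are different tuples.
\<close>
type_synonym policy = "nat \<times> (nat \<Rightarrow> real)"

definition policies :: "nat \<Rightarrow> real \<Rightarrow> real \<Rightarrow> policy set" where
  "policies T Umin Umax = (SIGMA c : {..<T}. {..c} \<rightarrow>\<^sub>E {Umin..Umax})"

definition express_share :: "real \<Rightarrow> real \<Rightarrow> real \<Rightarrow> real" where
  "express_share Umin Umax fee = (Umax - fee) / (Umax - Umin)"

text \<open>\<^const>\<open>poisson_pmf\<close> is specified only for a positive rate; with rate 0 the law is the point
  mass at 0.\<close>
definition poi :: "real \<Rightarrow> nat pmf" where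
  "poi r = (if 0 < r then poisson_pmf r else return_pmf 0)"

fun express_law :: "real \<Rightarrow> real \<Rightarrow> real \<Rightarrow> policy \<Rightarrow> nat \<Rightarrow> nat pmf" where
  "express_law lam Umin Umax (c, f) age =
     (if age \<le> c then poi (express_share Umin Umax (f age) * lam) else return_pmf 0)"

fun normal_law :: "real \<Rightarrow> real \<Rightarrow> real \<Rightarrow> policy \<Rightarrow> nat \<Rightarrow> nat pmf" where
  "normal_law lam Umin Umax (c, f) age =
     (if age \<le> c then poi ((1 - express_share Umin Umax (f age)) * lam) else poi lam)"

text \<open>
  The joint law of all the primitive random variables under a policy. An outcome \<open>\<omega>\<close> assigns to
  each time \<open>t\<close> the values of \<open>E\<^sub>t\<close>, \<open>N\<^sub>t\<close>, \<open>K\<^sub>t\<close>; they are independent within a period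
  (\<^const>\<open>pair_pmf\<close>) and across periods (infinite product measure).
\<close>
type_synonym outcome = "nat \<Rightarrow> nat \<times> nat \<times> nat"

definition outcome_measure ::
    "nat \<Rightarrow> real \<Rightarrow> real \<Rightarrow> real \<Rightarrow> nat pmf \<Rightarrow> policy \<Rightarrow> outcome measure" where
  "outcome_measure T lam Umin Umax K \<pi> =
     (\<Pi>\<^sub>M t\<in>UNIV. measure_pmf
        (pair_pmf (express_law lam Umin Umax \<pi> (t mod T))
           (pair_pmf (normal_law lam Umin Umax \<pi> (t mod T)) K)))"

definition express_demand :: "nat \<Rightarrow> outcome \<Rightarrow> nat" where
  "express_demand t \<omega> = fst (\<omega> t)"

definition normal_demand :: "nat \<Rightarrow> outcome \<Rightarrow> nat" where
  "normal_demand t \<omega> = fst (snd (\<omega> t))"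

definition capacity :: "nat \<Rightarrow> outcome \<Rightarrow> nat" where
  "capacity t \<omega> = snd (snd (\<omega> t))"

definition total_demand :: "nat \<Rightarrow> outcome \<Rightarrow> nat" where
  "total_demand t \<omega> = express_demand t \<omega> + normal_demand t \<omega>"

text \<open>In the recursions, truncated subtraction on \<^typ>\<open>nat\<close> is the positive part.\<close>

primrec total_backlog :: "nat \<Rightarrow> nat \<Rightarrow> outcome \<Rightarrow> nat" where
  "total_backlog xS 0 \<omega> = xS"
| "total_backlog xS (Suc t) \<omega> = total_backlog xS t \<omega> + total_demand t \<omega> - capacity t \<omega>"

primrec express_backlog :: "nat \<Rightarrow> nat \<Rightarrow> nat \<Rightarrow> nat \<Rightarrow> outcome \<Rightarrow> nat" where
  "express_backlog T xS xh 0 \<omega> = xh"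
| "express_backlog T xS xh (Suc t) \<omega> =
     (if t mod T \<noteq> T - 1
      then express_backlog T xS xh t \<omega> + express_demand t \<omega> - capacity t \<omega>
      else total_backlog xS t \<omega> + total_demand t \<omega> - capacity t \<omega>)"

definition cycle_backorders :: "nat \<Rightarrow> nat \<Rightarrow> nat \<Rightarrow> nat \<Rightarrow> outcome \<Rightarrow> nat" where
  "cycle_backorders T xS xh l \<omega> =
     (let t = l * T + (T - 1)
      in express_backlog T xS xh t \<omega> + express_demand t \<omega> - capacity t \<omega>)"

definition expected_backorders ::
    "nat \<Rightarrow> real \<Rightarrow> real \<Rightarrow> real \<Rightarrow> nat pmf \<Rightarrow> nat \<Rightarrow> nat \<Rightarrow> policy \<Rightarrow> real" where
  "expected_backorders T lam Umin Umax K xS xh \<pi> =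
     lim (\<lambda>L. (\<Sum>l<L. \<integral>\<omega>. real (cycle_backorders T xS xh l \<omega>)
                        \<partial>outcome_measure T lam Umin Umax K \<pi>) / real L)"

fun expected_revenue :: "real \<Rightarrow> real \<Rightarrow> real \<Rightarrow> policy \<Rightarrow> real" where
  "expected_revenue lam Umin Umax (c, f) =
     lam * (\<Sum>age\<le>c. f age * express_share Umin Umax (f age))"

definition expected_profit ::
    "nat \<Rightarrow> real \<Rightarrow> real \<Rightarrow> real \<Rightarrow> real \<Rightarrow> nat pmf \<Rightarrow> nat \<Rightarrow> nat \<Rightarrow> policy \<Rightarrow> real" where
  "expected_profit T lam \<beta> Umin Umax K xS xh \<pi> =
     expected_revenue lam Umin Umax \<pi> - \<beta> * expected_backorders T lam Umin Umax K xS xh \<pi>"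

text \<open>
  Computed in \<^typ>\<open>ennreal\<close>, where the mean of \<open>K\<close> always exists and a quotient with infinite
  denominator is 0.
\<close>
definition traffic_intensity :: "real \<Rightarrow> nat pmf \<Rightarrow> ennreal" where
  "traffic_intensity lam K = ennreal lam / (\<integral>\<^sup>+k. of_nat k \<partial>measure_pmf K)"

end

theory Submission
  imports Defs
begin

text \<open>
  A fee policy influences only how the demand of a cycle is split, never the total demand: in each
  period express and normal demand add up to a Poisson variable of the same rate. So the law of the
  total backlog at the beginning of a cycle is independent of the policy, and a policy matters only
  through the express rates that it imposes within the cycle.

  Permuting the fees of a policy leaves the revenue unchanged. It does change the backorders: express
  demand that arrives early can be served by the capacity of more periods before the cycle ends, so
  that it is best to have the large express rates, that is the small fees, first. Indeed, exchanging
  two neighbouring fees that are in decreasing order never increases the backlog at the end of the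
  cycle, pathwise under a suitable coupling (\<open>mean_step_swap\<close>), and insertion sort consists of such exchanges (\<open>mean_after_sort_le\<close>).
  Hence sorting the fees of any optimal policy yields an optimal policy with increasing fees.

  It remains to see that an optimal policy exists. The expected backorders of a cycle change by at
  most the total variation in the express rates (\<open>mean_after_rates_le\<close>), uniformly in the initial
  state, so that the long-run profit is continuous on a finite union of compact cubes of fees.

  Both arguments compare policies cycle by cycle and then pass to the long-run average, for which
  this average has to exist as a limit. This is where stability enters: since demand minus capacity
  has negative mean, some exponential moment of it is smaller than 1, and two copies of the backlog
  that are driven by the same demands and capacities merge at a geometric rate
  (\<open>mean_after_contraction\<close>). Consequently the expected backorders of successive cycles form a Cauchy sequence
  (\<open>convergent_mean_after_replicate\<close>).
\<close>

section \<open>Poisson laws\<close>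

text \<open>
  The binomial theorem. This is the source of every coupling below: an arrival stream of the larger of
  two rates is one of the smaller rate plus an independent surplus.
\<close>
lemma poi_add:
  assumes "0 \<le> a" "0 \<le> b"
  shows "poi (a + b) = map_pmf (\<lambda>(d, e). d + e) (pair_pmf (poi a) (poi b))"
proof (cases "a = 0 \<or> b = 0")
  case True
  then show ?thesis
    using assms
    by (auto simp: poi_def pair_return_pmf1 pair_return_pmf2 map_pmf_comp)
next
  case False
  with assms have pos: "0 < a" "0 < b" by auto
  show ?thesis
  proof (rule pmf_eqI)
    fix n :: nat
    have fiber: "(\<lambda>(d, e). d + e) -` {n} = (\<lambda>k. (k, n - k)) ` {..n}"
      by (auto simp: image_iff)
    have "pmf (map_pmf (\<lambda>(d, e). d + e) (pair_pmf (poi a) (poi b))) n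
        = (\<Sum>k\<le>n. pmf (poi a) k * pmf (poi b) (n - k))"
      unfolding pmf_map fiber
      by (subst measure_measure_pmf_finite) (auto simp: sum.reindex inj_on_def pmf_pair)
    also have "\<dots> = exp (- (a + b)) * (\<Sum>k\<le>n. (a ^ k /\<^sub>R fact k) * (b ^ (n - k) /\<^sub>R fact (n - k)))"
      using pos
      by (simp add: poi_def sum_distrib_left exp_add exp_minus exp_diff field_simps)
    also have "\<dots> = pmf (poi (a + b)) n"
      using pos exp_series_add_commuting[of a b n]
      by (simp add: poi_def field_simps)
    finally show "pmf (poi (a + b)) n = pmf (map_pmf (\<lambda>(d, e). d + e) (pair_pmf (poi a) (poi b))) n" ..
  qed
qed

lemma nn_integral_poi_add:
  assumes "0 \<le> a" "0 \<le> b"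
  shows "(\<integral>\<^sup>+d. h d \<partial>poi (a + b)) = (\<integral>\<^sup>+d. \<integral>\<^sup>+e. h (d + e) \<partial>poi b \<partial>poi a)"
  by (simp add: poi_add[OF assms] nn_integral_pair_pmf')

lemma nn_integral_pmf_commute:
  "(\<integral>\<^sup>+x. \<integral>\<^sup>+y. f x y \<partial>measure_pmf q \<partial>measure_pmf p)
    = (\<integral>\<^sup>+y. \<integral>\<^sup>+x. f x y \<partial>measure_pmf p \<partial>measure_pmf q)"
proof -
  have "(\<integral>\<^sup>+x. \<integral>\<^sup>+y. f x y \<partial>q \<partial>p) = (\<integral>\<^sup>+(x, y). f x y \<partial>pair_pmf p q)"
    by (simp add: nn_integral_pair_pmf')
  also have "\<dots> = (\<integral>\<^sup>+(y, x). f x y \<partial>pair_pmf q p)"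
    by (subst pair_commute_pmf) (simp add: case_prod_unfold)
  also have "\<dots> = (\<integral>\<^sup>+y. \<integral>\<^sup>+x. f x y \<partial>p \<partial>q)"
    by (simp add: nn_integral_pair_pmf')
  finally show ?thesis .
qed

lemma nn_integral_poi_exp:
  assumes "0 < r"
  shows "(\<integral>\<^sup>+d. ennreal (exp (\<theta> * real d)) \<partial>poi r) = ennreal (exp (r * (exp \<theta> - 1)))"
proof -
  have "(\<lambda>d. (r * exp \<theta>) ^ d /\<^sub>R fact d) sums exp (r * exp \<theta>)"
    by (rule exp_converges)
  from sums_mult[OF this, of "exp (- r)"]
  have s: "(\<lambda>d. pmf (poi r) d * exp (\<theta> * real d)) sums exp (r * (exp \<theta> - 1))"
    using assms
    by (simp add: poi_def power_mult_distrib exp_of_nat_mult[symmetric] mult_ac exp_diff exp_minus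
        field_simps)
  have "(\<integral>\<^sup>+d. ennreal (exp (\<theta> * real d)) \<partial>poi r)
      = (\<Sum>d. ennreal (pmf (poi r) d * exp (\<theta> * real d)))"
    by (simp add: nn_integral_measure_pmf nn_integral_count_space_nat ennreal_mult)
  also have "\<dots> = ennreal (exp (r * (exp \<theta> - 1)))"
    using s by (intro suminf_ennreal_eq) auto
  finally show ?thesis .
qed

lemma nn_integral_poi_mean:
  assumes "0 \<le> r"
  shows "(\<integral>\<^sup>+d. of_nat d \<partial>poi r) = ennreal r"
proof (cases "r = 0")
  case False
  with assms have r: "0 < r" by simp
  have "(\<lambda>d. r ^ d /\<^sub>R fact d) sums exp r"
    by (rule exp_converges)
  from sums_mult[OF this, of "r * exp (- r)"]
  have "(\<lambda>d. pmf (poi r) (Suc d) * real (Suc d)) sums r"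
    using r by (simp add: poi_def exp_minus field_simps del: of_nat_Suc)
  then have s: "(\<lambda>d. pmf (poi r) d * real d) sums r"
    using sums_Suc_iff[of "\<lambda>d. pmf (poi r) d * real d" r] by (simp del: of_nat_Suc)
  have "(\<integral>\<^sup>+d. of_nat d \<partial>poi r) = (\<Sum>d. ennreal (pmf (poi r) d * real d))"
    by (simp add: nn_integral_measure_pmf nn_integral_count_space_nat ennreal_mult
        ennreal_of_nat_eq_real_of_nat)
  also have "\<dots> = ennreal r"
    using s by (intro suminf_ennreal_eq) auto
  finally show ?thesis .
qed (simp add: poi_def)

section \<open>Expected values along the backlog recursion\<close>

text \<open>
  The one-period transition operator of a Lindley recursion with Poisson demand of rate \<open>a\<close>: the
  mean of \<open>h\<close> at the next backlog, as a function of the present backlog. Working with values in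
  \<^typ>\<open>ennreal\<close> removes all integrability side conditions; real numbers are needed only for limits
  in time.
\<close>
definition mean_step :: "nat pmf \<Rightarrow> real \<Rightarrow> (nat \<Rightarrow> ennreal) \<Rightarrow> nat \<Rightarrow> ennreal" where
  "mean_step K a h x = (\<integral>\<^sup>+d. \<integral>\<^sup>+k. h (x + d - k) \<partial>K \<partial>poi a)"

text \<open>
  The head of the list is the rate of the earliest period; it is applied outermost, since one first
  conditions on what happens in the first period.
\<close>
abbreviation mean_after :: "nat pmf \<Rightarrow> real list \<Rightarrow> (nat \<Rightarrow> ennreal) \<Rightarrow> nat \<Rightarrow> ennreal" where
  "mean_after K rates h \<equiv> foldr (mean_step K) rates h"

lemma mean_step_mono: "h \<le> h' \<Longrightarrow> mean_step K a h \<le> mean_step K a h'"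
  unfolding mean_step_def le_fun_def by (auto intro!: nn_integral_mono)

lemma mono_mean_step: "mono h \<Longrightarrow> mono (mean_step K a h)"
  unfolding mean_step_def mono_def by (auto intro!: nn_integral_mono)

lemma mean_after_mono: "h \<le> h' \<Longrightarrow> mean_after K rates h \<le> mean_after K rates h'"
  by (induction rates) (auto intro: mean_step_mono)

lemma mono_mean_after: "mono h \<Longrightarrow> mono (mean_after K rates h)"
  by (induction rates) (auto intro: mono_mean_step)

text \<open>
  The interchange argument. Write the larger demand as \<open>d + q\<close>, with \<open>d\<close> of the smaller rate
  and \<open>q\<close> an independent surplus. If \<open>q\<close> arrives in the first of the two periods, then the capacity
  of that period may already serve part of it; if it arrives in the second, that chance is lost.
  So the backlog at the end is pathwise at most as large when the surplus comes first.
\<close>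
lemma mean_step_swap:
  assumes "0 \<le> a" "a \<le> b" "mono h"
  shows "mean_step K b (mean_step K a h) \<le> mean_step K a (mean_step K b h)"
proof (rule le_funI)
  fix x
  have b: "b = a + (b - a)" by simp
  have "mean_step K b (mean_step K a h) x
      = (\<integral>\<^sup>+d. \<integral>\<^sup>+q. \<integral>\<^sup>+k. \<integral>\<^sup>+e. \<integral>\<^sup>+j. h (x + (d + q) - k + e - j) \<partial>K \<partial>poi a \<partial>K \<partial>poi (b - a) \<partial>poi a)"
    unfolding mean_step_def
    by (subst b, subst nn_integral_poi_add) (use assms in simp_all)
  also have "\<dots> \<le> (\<integral>\<^sup>+d. \<integral>\<^sup>+q. \<integral>\<^sup>+k. \<integral>\<^sup>+e. \<integral>\<^sup>+j. h (x + d - k + (e + q) - j) \<partial>K \<partial>poi a \<partial>K \<partial>poi (b - a) \<partial>poi a)"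
    by (intro nn_integral_mono monoD[OF assms(3)]) auto
  also have "\<dots> = (\<integral>\<^sup>+d. \<integral>\<^sup>+k. \<integral>\<^sup>+e. \<integral>\<^sup>+q. \<integral>\<^sup>+j. h (x + d - k + (e + q) - j) \<partial>K \<partial>poi (b - a) \<partial>poi a \<partial>K \<partial>poi a)"
    by (subst nn_integral_pmf_commute[where p = "poi (b - a)" and q = K],
        subst nn_integral_pmf_commute[where p = "poi (b - a)" and q = "poi a"]) (rule refl)
  also have "\<dots> = (\<integral>\<^sup>+d. \<integral>\<^sup>+k. (\<integral>\<^sup>+e. \<integral>\<^sup>+j. h (x + d - k + e - j) \<partial>K \<partial>poi (a + (b - a))) \<partial>K \<partial>poi a)"
    by (subst nn_integral_poi_add) (use assms in simp_all)
  also have "\<dots> = mean_step K a (mean_step K b h) x"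
    by (simp add: mean_step_def)
  finally show "mean_step K b (mean_step K a h) x \<le> mean_step K a (mean_step K b h) x" .
qed

text \<open>
  Insertion sort only interchanges neighbours that are in the wrong order, and each interchange moves
  the larger of the two rates to the earlier period. As \<open>rate\<close> is antitone, increasing values
  are decreasing rates.
\<close>
lemma mean_after_sort_le:
  fixes rate :: "'a :: linorder \<Rightarrow> real"
  assumes "antimono rate" "\<And>x. x \<in> set xs \<Longrightarrow> 0 \<le> rate x" "mono h"
  shows "mean_after K (map rate (sort xs)) h \<le> mean_after K (map rate xs) h"
proof -
  have ins: "mean_after K (map rate (insort y ys)) h \<le> mean_after K (map rate (y # ys)) h"
    if "\<And>x. x \<in> set (y # ys) \<Longrightarrow> 0 \<le> rate x" for y ys
    using that
  proof (induction ys)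
    case (Cons z zs)
    show ?case
    proof (cases "y \<le> z")
      case False
      then have "rate y \<le> rate z"
        using assms(1) by (auto intro: antimonoD)
      have "mean_after K (map rate (insort y (z # zs))) h
          = mean_step K (rate z) (mean_after K (map rate (insort y zs)) h)"
        using False by simp
      also have "\<dots> \<le> mean_step K (rate z) (mean_after K (map rate (y # zs)) h)"
        using Cons.prems by (intro mean_step_mono Cons.IH) auto
      also have "\<dots> \<le> mean_after K (map rate (y # z # zs)) h"
        using mean_step_swap[OF _ \<open>rate y \<le> rate z\<close> mono_mean_after[OF assms(3)]] Cons.prems by simp
      finally show ?thesis .
    qed simp
  qed simp
  show ?thesis
    using assms(2)
  proof (induction xs)
    case (Cons x xs)
    have "mean_after K (map rate (sort (x # xs))) h \<le> mean_after K (map rate (x # sort xs)) h"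
      using ins[of x "sort xs"] Cons.prems by simp
    also have "\<dots> \<le> mean_after K (map rate (x # xs)) h"
      using Cons by (auto intro: mean_step_mono)
    finally show ?case .
  qed simp
qed

text \<open>
  Backlogs are monotone and 1-Lipschitz in the initial state and in every single demand. The class is
  closed under \<open>mean_step\<close>, so an estimate for one period can be used in every period.
\<close>
definition nonexpansive :: "(nat \<Rightarrow> ennreal) \<Rightarrow> bool" where
  "nonexpansive h \<longleftrightarrow> mono h \<and> (\<forall>x n. h (x + n) \<le> h x + of_nat n)"

lemma nonexpansive_of_nat: "nonexpansive of_nat"
  by (auto simp: nonexpansive_def mono_def)

lemma nonexpansive_le: "nonexpansive h \<Longrightarrow> y \<le> x + n \<Longrightarrow> h y \<le> h x + of_nat n"
  unfolding nonexpansive_def using monoD order_trans by meson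

lemma nonexpansive_mean_step:
  assumes "nonexpansive h"
  shows "nonexpansive (mean_step K a h)"
  unfolding nonexpansive_def
proof (intro conjI allI)
  show "mono (mean_step K a h)"
    using assms by (auto simp: nonexpansive_def intro: mono_mean_step)
  fix x n
  have "mean_step K a h (x + n) \<le> (\<integral>\<^sup>+d. \<integral>\<^sup>+k. h (x + d - k) + of_nat n \<partial>K \<partial>poi a)"
    unfolding mean_step_def
    by (intro nn_integral_mono nonexpansive_le[OF assms]) auto
  also have "\<dots> = mean_step K a h x + of_nat n"
    by (simp add: mean_step_def nn_integral_add)
  finally show "mean_step K a h (x + n) \<le> mean_step K a h x + of_nat n" .
qed

lemma nonexpansive_mean_after: "nonexpansive h \<Longrightarrow> nonexpansive (mean_after K rates h)"
  by (induction rates) (auto intro: nonexpansive_mean_step)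

text \<open>
  If the rate increases, the surplus of mean \<open>b - a\<close> changes the argument of \<open>h\<close> by at most its own
  size. If the rate decreases, monotonicity suffices, and the coercion to \<^typ>\<open>ennreal\<close> turns the
  negative difference into 0.
\<close>
lemma mean_step_rate_le:
  assumes "nonexpansive h" "0 \<le> a" "0 \<le> b"
  shows "mean_step K b h x \<le> mean_step K a h x + ennreal (b - a)"
proof (cases "a \<le> b")
  case True
  have "mean_step K b h x = (\<integral>\<^sup>+d. \<integral>\<^sup>+e. \<integral>\<^sup>+k. h (x + (d + e) - k) \<partial>K \<partial>poi (b - a) \<partial>poi a)"
    using nn_integral_poi_add[of a "b - a"] True assms by (simp add: mean_step_def)
  also have "\<dots> \<le> (\<integral>\<^sup>+d. \<integral>\<^sup>+e. \<integral>\<^sup>+k. h (x + d - k) + of_nat e \<partial>K \<partial>poi (b - a) \<partial>poi a)"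
    by (intro nn_integral_mono nonexpansive_le[OF assms(1)]) auto
  also have "\<dots> = mean_step K a h x + ennreal (b - a)"
    using True by (simp add: mean_step_def nn_integral_add nn_integral_poi_mean)
  finally show ?thesis .
next
  case False
  have "mono h"
    using assms by (simp add: nonexpansive_def)
  have "mean_step K b h x \<le> (\<integral>\<^sup>+d. \<integral>\<^sup>+e. \<integral>\<^sup>+k. h (x + (d + e) - k) \<partial>K \<partial>poi (a - b) \<partial>poi b)"
  proof -
    have "mean_step K b h x = (\<integral>\<^sup>+d. \<integral>\<^sup>+e. \<integral>\<^sup>+k. h (x + d - k) \<partial>K \<partial>poi (a - b) \<partial>poi b)"
      by (simp add: mean_step_def)
    also have "\<dots> \<le> (\<integral>\<^sup>+d. \<integral>\<^sup>+e. \<integral>\<^sup>+k. h (x + (d + e) - k) \<partial>K \<partial>poi (a - b) \<partial>poi b)"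
      by (intro nn_integral_mono monoD[OF \<open>mono h\<close>]) auto
    finally show ?thesis .
  qed
  also have "\<dots> = mean_step K a h x"
    using nn_integral_poi_add[of b "a - b"] False assms by (simp add: mean_step_def)
  finally show ?thesis
    by (simp add: add_increasing2)
qed

text \<open>
  All transition operators preserve constants, because they are means with respect to probabilities.
\<close>
lemma mean_after_add_const:
  "mean_after K rates (\<lambda>x. h x + c) x = mean_after K rates h x + c"
  by (induction rates arbitrary: x) (auto simp: mean_step_def nn_integral_add fun_eq_iff)

lemma mean_after_rates_le:
  assumes "nonexpansive h" "\<And>i. i \<in> set js \<Longrightarrow> 0 \<le> a i" "\<And>i. i \<in> set js \<Longrightarrow> 0 \<le> b i"
  shows "mean_after K (map b js) h x \<le> mean_after K (map a js) h x + (\<Sum>i\<leftarrow>js. ennreal (b i - a i))"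
  using assms(2,3)
proof (induction js arbitrary: x)
  case (Cons i js)
  let ?c = "\<Sum>i\<leftarrow>js. ennreal (b i - a i)"
  have "mean_after K (map b (i # js)) h x
      \<le> mean_step K (b i) (\<lambda>x. mean_after K (map a js) h x + ?c) x"
    using Cons by (auto intro!: le_funD[OF mean_step_mono] le_funI)
  also have "\<dots> = mean_step K (b i) (mean_after K (map a js) h) x + ?c"
    using mean_after_add_const[of K "[b i]"] by simp
  also have "\<dots> \<le> mean_step K (a i) (mean_after K (map a js) h) x + ennreal (b i - a i) + ?c"
    using Cons.prems
    by (intro add_right_mono mean_step_rate_le nonexpansive_mean_after assms(1)) auto
  finally show ?case
    by (simp add: add_ac)
qed simp

section \<open>Convergence of sequences and Cesaro means\<close>

lemma tendsto_cesaro_mean: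
  fixes a :: "nat \<Rightarrow> real"
  assumes "a \<longlonglongrightarrow> L"
  shows "(\<lambda>n. (\<Sum>l<n. a l) / real n) \<longlonglongrightarrow> L"
proof (rule LIMSEQ_I)
  fix e :: real
  assume e: "0 < e"
  with assms obtain N where N: "\<And>l. N \<le> l \<Longrightarrow> \<bar>a l - L\<bar> < e / 2"
    using LIMSEQ_D[of a L "e / 2"] by auto
  define S where "S = (\<Sum>l<N. \<bar>a l - L\<bar>)"
  obtain m :: nat where m: "2 * S / e < real m"
    using reals_Archimedean2 by blast
  show "\<exists>n0. \<forall>n\<ge>n0. norm ((\<Sum>l<n. a l) / real n - L) < e"
  proof (intro exI allI impI)
    fix n
    assume n: "max (Suc N) m \<le> n"
    then have "0 < real n" by simp
    have "S < real n * (e / 2)"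
    proof -
      have "2 * S / e < real n"
        using m n by linarith
      then show ?thesis
        using e by (simp add: field_simps)
    qed
    have split: "{..<n} = {..<N} \<union> {N..<n}" "{..<N} \<inter> {N..<n} = {}"
      using n by auto
    have "\<bar>(\<Sum>l<n. a l) - real n * L\<bar> = \<bar>\<Sum>l<n. a l - L\<bar>"
      by (simp add: sum_subtractf)
    also have "\<dots> \<le> (\<Sum>l<n. \<bar>a l - L\<bar>)"
      by (rule sum_abs)
    also have "\<dots> = S + (\<Sum>l\<in>{N..<n}. \<bar>a l - L\<bar>)"
      unfolding S_def split(1) by (rule sum.union_disjoint) (use split(2) in auto)
    also have "(\<Sum>l\<in>{N..<n}. \<bar>a l - L\<bar>) \<le> (\<Sum>l\<in>{N..<n}. e / 2)"
      using N by (intro sum_mono) (auto intro: less_imp_le)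
    also have "S + (\<Sum>l\<in>{N..<n}. e / 2) \<le> S + real n * (e / 2)"
      using e by (auto intro!: mult_right_mono)
    also have "\<dots> < real n * e"
      using \<open>S < real n * (e / 2)\<close> by simp
    finally have "\<bar>(\<Sum>l<n. a l) - real n * L\<bar> < real n * e" by simp
    moreover have "(\<Sum>l<n. a l) / real n - L = ((\<Sum>l<n. a l) - real n * L) / real n"
      using \<open>0 < real n\<close> by (simp add: field_simps)
    ultimately show "norm ((\<Sum>l<n. a l) / real n - L) < e"
      using \<open>0 < real n\<close> by (simp add: field_simps)
  qed
qed

lemma convergent_if_geometric_increments:
  fixes a :: "nat \<Rightarrow> real"
  assumes "\<And>n. \<bar>a (Suc n) - a n\<bar> \<le> C * r ^ n" "0 \<le> r" "r < 1"
  shows "convergent a"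
proof -
  have "summable (\<lambda>n. C * r ^ n)"
    using assms by (intro summable_mult summable_geometric) auto
  then have "summable (\<lambda>n. a (Suc n) - a n)"
    by (rule summable_comparison_test') (use assms(1) in simp)
  then have "convergent (\<lambda>m. \<Sum>n<m. a (Suc n) - a n)"
    by (simp add: summable_iff_convergent)
  from convergent_add[OF this convergent_const[of "a 0"]] show ?thesis
    by (simp add: sum_lessThan_telescope)
qed

section \<open>Geometric ergodicity of the total backlog\<close>

text \<open>
  The mean of \<open>K\<close> may be infinite. Cutting \<open>K\<close> off at a high level leaves a variable of finite range
  that is still larger than \<open>lam\<close> on average, by monotone convergence.
\<close>
lemma exists_truncated_mean_above:
  assumes "0 < lam" "traffic_intensity lam K < 1"
  obtains M :: nat where "lam < measure_pmf.expectation (map_pmf (min M) K) real"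
proof -
  have "ennreal lam < (\<integral>\<^sup>+k. of_nat k \<partial>K)"
  proof (rule ccontr)
    let ?m = "\<integral>\<^sup>+k. of_nat k \<partial>measure_pmf K"
    assume "\<not> ennreal lam < ?m"
    then have le: "?m \<le> ennreal lam" by simp
    then have fin: "?m < \<top>"
      using le_less_trans ennreal_less_top by blast
    show False
    proof (cases "?m = 0")
      case True
      then show False
        using assms by (simp add: traffic_intensity_def ennreal_divide_zero)
    next
      case False
      have "1 = ?m / ?m"
        using False fin by (simp add: ennreal_divide_self)
      also have "\<dots> \<le> traffic_intensity lam K"
        unfolding traffic_intensity_def by (rule divide_right_mono_ennreal[OF le])
      finally show False
        using assms(2) by simp
    qed
  qed
  also have "(\<integral>\<^sup>+k. of_nat k \<partial>K) = (\<integral>\<^sup>+k. (SUP M. of_nat (min M k)) \<partial>K)"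
  proof (intro nn_integral_cong)
    fix k :: nat
    show "(of_nat k :: ennreal) = (SUP M. of_nat (min M k))"
      by (intro antisym SUP_upper2[of k] SUP_least) auto
  qed
  also have "\<dots> = (SUP M. \<integral>\<^sup>+k. of_nat (min M k) \<partial>K)"
    by (intro nn_integral_monotone_convergence_SUP) (auto simp: incseq_def le_fun_def)
  finally obtain M where M: "ennreal lam < (\<integral>\<^sup>+k. of_nat (min M k) \<partial>K)"
    unfolding less_SUP_iff by auto
  have "(\<integral>\<^sup>+k. of_nat (min M k) \<partial>K) = (\<integral>\<^sup>+k. ennreal (real k) \<partial>map_pmf (min M) K)"
    by (simp add: ennreal_of_nat_eq_real_of_nat)
  also have "\<dots> = ennreal (measure_pmf.expectation (map_pmf (min M) K) real)"
    by (intro nn_integral_eq_integral measure_pmf.integrable_const_bound[where B = "real M"])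
      (auto simp: AE_measure_pmf_iff)
  finally have "lam < measure_pmf.expectation (map_pmf (min M) K) real"
    using M assms(1) by (simp add: ennreal_less_iff)
  then show thesis ..
qed

text \<open>
  Let \<open>\<phi> \<theta>\<close> be the moment generating function of demand minus truncated capacity. Then \<open>\<phi> 0 = 1\<close>, and
  the derivative of \<open>\<phi>\<close> at 0 is the mean of this difference, which is negative. Hence \<open>\<phi> \<theta> < 1\<close> for small positive
  \<open>\<theta>\<close>, and replacing the truncated capacity by the larger \<open>K\<close> only decreases the expectation.
\<close>
lemma exists_exponential_drift:
  assumes "0 < lam" "traffic_intensity lam K < 1"
  obtains \<theta> r :: real where "0 < \<theta>" "0 \<le> r" "r < 1"
    "(\<integral>\<^sup>+d. \<integral>\<^sup>+k. ennreal (exp (\<theta> * (real d - real k))) \<partial>K \<partial>poi lam) \<le> ennreal r"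
proof -
  obtain M where M: "lam < measure_pmf.expectation (map_pmf (min M) K) real"
    using exists_truncated_mean_above[OF assms] .
  define p where "p = pmf (map_pmf (min M) K)"
  have expect: "measure_pmf.expectation (map_pmf (min M) K) f = (\<Sum>k\<le>M. f k * p k)"
    for f :: "nat \<Rightarrow> real"
    unfolding p_def by (intro integral_measure_pmf_real) auto
  define \<phi> where "\<phi> \<theta> = exp (lam * (exp \<theta> - 1)) * (\<Sum>k\<le>M. exp (- (\<theta> * real k)) * p k)" for \<theta> :: real
  have sum_p: "(\<Sum>k\<le>M. p k) = 1"
    using expect[of "\<lambda>_. 1"] by simp
  have "\<phi> 0 = 1"
    using sum_p by (simp add: \<phi>_def)
  have "(\<phi> has_real_derivative (lam - (\<Sum>k\<le>M. real k * p k))) (at 0)"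
    unfolding \<phi>_def
    by (auto intro!: derivative_eq_intros simp: sum_p sum_negf)
  moreover have "lam - (\<Sum>k\<le>M. real k * p k) < 0"
    using M unfolding expect by simp
  ultimately have "\<exists>\<delta>>0. \<forall>h>0. h < \<delta> \<longrightarrow> \<phi> (0 + h) < \<phi> 0"
    by (rule DERIV_neg_dec_right) 
  then obtain \<delta> where \<delta>: "0 < \<delta>" "\<And>h. 0 < h \<Longrightarrow> h < \<delta> \<Longrightarrow> \<phi> h < \<phi> 0"
    by auto
  define \<theta> where "\<theta> = \<delta> / 2"
  have \<theta>: "0 < \<theta>" "\<phi> \<theta> < 1"
    using \<delta> \<open>\<phi> 0 = 1\<close> by (auto simp: \<theta>_def)
  have p_nonneg: "0 \<le> p k" for k
    by (simp add: p_def)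
  have "0 \<le> \<phi> \<theta>"
    unfolding \<phi>_def by (intro mult_nonneg_nonneg sum_nonneg) (auto simp: p_nonneg)
  have "(\<integral>\<^sup>+k. ennreal (exp (- (\<theta> * real k))) \<partial>K)
      \<le> (\<integral>\<^sup>+k. ennreal (exp (- (\<theta> * real (min M k)))) \<partial>K)"
    using \<theta> by (intro nn_integral_mono ennreal_leI) (auto simp: min_def)
  also have "\<dots> = (\<integral>\<^sup>+k. ennreal (exp (- (\<theta> * real k))) \<partial>map_pmf (min M) K)"
    by simp
  also have "\<dots> = ennreal (\<Sum>k\<le>M. exp (- (\<theta> * real k)) * p k)"
    unfolding expect[symmetric] using \<theta>
    by (intro nn_integral_eq_integral measure_pmf.integrable_const_bound[where B = 1])
      (auto simp: AE_measure_pmf_iff)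
  finally have K_le: "(\<integral>\<^sup>+k. ennreal (exp (- (\<theta> * real k))) \<partial>K)
      \<le> ennreal (\<Sum>k\<le>M. exp (- (\<theta> * real k)) * p k)" .
  have "(\<integral>\<^sup>+d. \<integral>\<^sup>+k. ennreal (exp (\<theta> * (real d - real k))) \<partial>K \<partial>poi lam)
      = (\<integral>\<^sup>+d. \<integral>\<^sup>+k. ennreal (exp (\<theta> * real d)) * ennreal (exp (- (\<theta> * real k))) \<partial>K \<partial>poi lam)"
    by (simp add: ennreal_mult[symmetric] exp_add[symmetric] algebra_simps)
  also have "\<dots> = ennreal (exp (lam * (exp \<theta> - 1))) * (\<integral>\<^sup>+k. ennreal (exp (- (\<theta> * real k))) \<partial>K)"
    using nn_integral_poi_exp[OF assms(1)] by (simp add: nn_integral_cmult nn_integral_multc)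
  also have "\<dots> \<le> ennreal (\<phi> \<theta>)"
    unfolding \<phi>_def using K_le by (subst ennreal_mult') (auto intro: mult_left_mono)
  finally show thesis
    using that[of \<theta> "\<phi> \<theta>"] \<theta> \<open>0 \<le> \<phi> \<theta>\<close> by blast
qed

text \<open>
  Run the recursion from \<open>x\<close> and from \<open>y \<ge> x\<close> with the same demands and capacities. Their distance never
  grows, and it vanishes as soon as the upper path hits 0. As long as the upper path has not hit 0 it is
  an unreflected random walk started in \<open>y\<close>, and the probability that the walk is still
  nonnegative after \<open>n\<close> steps is at most \<open>r ^ n * exp (\<theta> * y)\<close> by exponential Markov. The induction
  carries out this estimate one step at a time.
\<close>
lemma mean_after_contraction:
  fixes K :: "nat pmf"
  assumes "nonexpansive h" "0 < \<theta>" "0 \<le> r"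
    and drift: "(\<integral>\<^sup>+d. \<integral>\<^sup>+k. ennreal (exp (\<theta> * (real d - real k))) \<partial>K \<partial>poi lam) \<le> ennreal r"
    and "x \<le> y"
  shows "mean_after K (replicate n lam) h y
    \<le> mean_after K (replicate n lam) h x + ennreal (r ^ n * real (y - x) * exp (\<theta> * real y))"
  using \<open>x \<le> y\<close>
proof (induction n arbitrary: x y)
  case 0
  have "h y \<le> h x + of_nat (y - x)"
    using 0 by (intro nonexpansive_le[OF assms(1)]) auto
  also have "\<dots> \<le> h x + ennreal (real (y - x) * exp (\<theta> * real y))"
    unfolding ennreal_of_nat_eq_real_of_nat using assms(2)
    by (intro add_left_mono ennreal_leI mult_left_le[THEN order_trans] mult_le_cancel_left1[THEN iffD2]) auto
  finally show ?case by simp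
next
  case (Suc n)
  let ?H = "mean_after K (replicate n lam) h"
  let ?c = "r ^ n * real (y - x) * exp (\<theta> * real y)"
  have pt: "?H (y + d - k) \<le> ?H (x + d - k) + ennreal ?c * ennreal (exp (\<theta> * (real d - real k)))"
    for d k
  \<comment> \<open>In the first case both paths are at 0 after this period and have merged. In the second
    the upper one has not been truncated, so that the exponential factorizes exactly.\<close>
  proof (cases "y + d \<le> k")
    case True
    then show ?thesis
      using \<open>x \<le> y\<close> by simp
  next
    case False
    have "?H (y + d - k) \<le> ?H (x + d - k)
        + ennreal (r ^ n * real (y + d - k - (x + d - k)) * exp (\<theta> * real (y + d - k)))"
      using \<open>x \<le> y\<close> by (intro Suc.IH) auto
    also have "\<dots> \<le> ?H (x + d - k) + ennreal (r ^ n * real (y - x) * exp (\<theta> * real (y + d - k)))"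
      using assms(3) by (intro add_left_mono ennreal_leI mult_right_mono mult_left_mono) auto
    also have "exp (\<theta> * real (y + d - k)) = exp (\<theta> * real y) * exp (\<theta> * (real d - real k))"
      using False by (simp add: exp_add[symmetric] algebra_simps of_nat_diff)
    finally show ?thesis
      using assms(3) by (simp add: ennreal_mult[symmetric] mult_ac)
  qed
  have "mean_after K (replicate (Suc n) lam) h y
      \<le> (\<integral>\<^sup>+d. \<integral>\<^sup>+k. ?H (x + d - k) + ennreal ?c * ennreal (exp (\<theta> * (real d - real k))) \<partial>K \<partial>poi lam)"
    unfolding replicate_Suc foldr_Cons o_apply mean_step_def[of K lam ?H y]
    by (intro nn_integral_mono pt)
  also have "\<dots> = mean_after K (replicate (Suc n) lam) h x
      + ennreal ?c * (\<integral>\<^sup>+d. \<integral>\<^sup>+k. ennreal (exp (\<theta> * (real d - real k))) \<partial>K \<partial>poi lam)"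
    by (simp add: mean_step_def[of K lam ?H x] nn_integral_add nn_integral_cmult del: foldr_replicate)
  also have "\<dots> \<le> mean_after K (replicate (Suc n) lam) h x + ennreal ?c * ennreal r"
    by (intro add_left_mono mult_left_mono drift) auto
  also have "ennreal ?c * ennreal r = ennreal (r ^ Suc n * real (y - x) * exp (\<theta> * real y))"
    using assms(3) by (simp add: ennreal_mult[symmetric] mult_ac)
  finally show ?case .
qed

lemma mean_after_le:
  assumes "nonexpansive h" "\<And>a. a \<in> set rates \<Longrightarrow> 0 \<le> a"
  shows "mean_after K rates h x \<le> h x + (\<Sum>a\<leftarrow>rates. ennreal a)"
  using assms(2)
proof (induction rates)
  case (Cons a rates)
  let ?H = "mean_after K rates h"
  have "mean_after K (a # rates) h x \<le> (\<integral>\<^sup>+d. \<integral>\<^sup>+k. ?H x + of_nat d \<partial>K \<partial>poi a)"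
    unfolding foldr_Cons o_apply mean_step_def[of K a]
    by (intro nn_integral_mono nonexpansive_le[OF nonexpansive_mean_after[OF assms(1)]]) auto
  also have "\<dots> = ?H x + ennreal a"
    using Cons.prems by (simp add: nn_integral_add nn_integral_poi_mean)
  also have "\<dots> \<le> h x + (\<Sum>a\<leftarrow>rates. ennreal a) + ennreal a"
    using Cons by (intro add_right_mono) auto
  finally show ?case
    by (simp add: add_ac)
qed simp

lemma mean_after_finite:
  assumes "nonexpansive h" "\<And>a. a \<in> set rates \<Longrightarrow> 0 \<le> a" "h x < \<top>"
  shows "mean_after K rates h x < \<top>"
proof -
  have "(\<Sum>a\<leftarrow>rates. ennreal a) < \<top>"
    by (induction rates) auto
  then show ?thesis
    using mean_after_le[OF assms(1,2)] assms(3) le_less_trans by (metis ennreal_add_less_top)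
qed

text \<open>
  Conditioning on the first of \<open>n + 1\<close> periods, \<open>H (n + 1) x\<close> is the mean of \<open>H n\<close> over the states
  that follow \<open>x\<close>; by the contraction it differs from \<open>H n x\<close> by at most a constant times \<open>r ^ n\<close>.
\<close>
lemma convergent_mean_after_replicate:
  assumes "0 < lam" "traffic_intensity lam K < 1"
    and "nonexpansive h" "h x < \<top>"
  shows "convergent (\<lambda>n. enn2real (mean_after K (replicate n lam) h x))"
proof -
  obtain \<theta> r where \<theta>: "0 < \<theta>" and r: "0 \<le> r" "r < 1"
    and drift: "(\<integral>\<^sup>+d. \<integral>\<^sup>+k. ennreal (exp (\<theta> * (real d - real k))) \<partial>K \<partial>poi lam) \<le> ennreal r"
    using exists_exponential_drift[OF assms(1,2)] .
  define H where "H n = mean_after K (replicate n lam) h" for n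
  have H_Suc: "H (Suc n) = mean_step K lam (H n)" for n
    by (simp add: H_def)
  have contr: "H n y \<le> H n z + ennreal (r ^ n * real (y - z) * exp (\<theta> * real y))" if "z \<le> y" for n z y
    unfolding H_def using mean_after_contraction[OF assms(3) \<theta> r(1) drift that] .
  have monoH: "mono (H n)" for n
    using nonexpansive_mean_after[OF assms(3)] unfolding H_def nonexpansive_def by blast
  have fin: "H n x < \<top>" for n
    unfolding H_def using assms by (intro mean_after_finite) auto
  define A where "A = exp (\<theta> * real x) / \<theta> * exp (lam * (exp (2 * \<theta>) - 1))"
  define B where "B = real x * exp (\<theta> * real x)"
  have up: "H (Suc n) x \<le> H n x + ennreal (A * r ^ n)" for n
  proof -
    \<comment> \<open>The linear factor \<open>d\<close> of the contraction estimate is absorbed into an exponential, so that only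
      exponential moments of the demand are needed.\<close>
    have pt: "H n (x + d - k) \<le> H n x + ennreal (r ^ n * exp (\<theta> * real x) / \<theta>) * ennreal (exp (2 * \<theta> * real d))"
      for d k
    proof -
      have "\<theta> * real d \<le> exp (\<theta> * real d)"
        using exp_ge_add_one_self[of "\<theta> * real d"] by linarith
      then have "real d \<le> exp (\<theta> * real d) / \<theta>"
        using \<theta> by (simp add: pos_le_divide_eq mult.commute)
      then have "real d * exp (\<theta> * real d) \<le> exp (\<theta> * real d) / \<theta> * exp (\<theta> * real d)"
        by (intro mult_right_mono) auto
      also have "\<dots> = exp (2 * \<theta> * real d) / \<theta>"
        by (simp add: exp_add[symmetric])
      finally have d: "real d * exp (\<theta> * real d) \<le> exp (2 * \<theta> * real d) / \<theta>" .
      have "H n (x + d - k) \<le> H n (x + d)"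
        by (intro monoD[OF monoH]) auto
      also have "\<dots> \<le> H n x + ennreal (r ^ n * real (x + d - x) * exp (\<theta> * real (x + d)))"
        by (intro contr) auto
      also have "r ^ n * real (x + d - x) * exp (\<theta> * real (x + d))
          = r ^ n * exp (\<theta> * real x) * (real d * exp (\<theta> * real d))"
        by (simp add: exp_add algebra_simps)
      also have "H n x + ennreal \<dots> \<le> H n x + ennreal (r ^ n * exp (\<theta> * real x) * (exp (2 * \<theta> * real d) / \<theta>))"
        using r d by (intro add_left_mono ennreal_leI mult_left_mono) auto
      also have "ennreal (r ^ n * exp (\<theta> * real x) * (exp (2 * \<theta> * real d) / \<theta>))
          = ennreal (r ^ n * exp (\<theta> * real x) / \<theta>) * ennreal (exp (2 * \<theta> * real d))"
        by (subst ennreal_mult[symmetric]) (use r \<theta> in simp_all)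
      finally show ?thesis .
    qed
    have "H (Suc n) x \<le> (\<integral>\<^sup>+d. \<integral>\<^sup>+k. H n x + ennreal (r ^ n * exp (\<theta> * real x) / \<theta>) *
        ennreal (exp (2 * \<theta> * real d)) \<partial>K \<partial>poi lam)"
      unfolding H_Suc mean_step_def by (intro nn_integral_mono pt)
    also have "\<dots> = H n x + ennreal (r ^ n * exp (\<theta> * real x) / \<theta>) * ennreal (exp (lam * (exp (2 * \<theta>) - 1)))"
      using nn_integral_poi_exp[OF assms(1), of "2 * \<theta>"] by (simp add: nn_integral_add nn_integral_cmult)
    also have "\<dots> = H n x + ennreal (A * r ^ n)"
      using r \<theta> by (simp add: A_def ennreal_mult[symmetric] mult_ac)
    finally show ?thesis .
  qed
  have down: "H n x \<le> H (Suc n) x + ennreal (B * r ^ n)" for n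
  proof -
    have pt: "H n x \<le> H n (x + d - k) + ennreal (B * r ^ n)" for d k
    proof (cases "x \<le> x + d - k")
      case True
      then show ?thesis
        using monoD[OF monoH True] by (intro add_increasing2) auto
    next
      case False
      then have "H n x \<le> H n (x + d - k) + ennreal (r ^ n * real (x - (x + d - k)) * exp (\<theta> * real x))"
        by (intro contr) auto
      also have "\<dots> \<le> H n (x + d - k) + ennreal (r ^ n * real x * exp (\<theta> * real x))"
        using r by (intro add_left_mono ennreal_leI mult_right_mono mult_left_mono) auto
      finally show ?thesis
        by (simp add: B_def mult_ac)
    qed
    have "H n x = (\<integral>\<^sup>+d. \<integral>\<^sup>+k. H n x \<partial>K \<partial>poi lam)"
      by simp
    also have "\<dots> \<le> (\<integral>\<^sup>+d. \<integral>\<^sup>+k. H n (x + d - k) + ennreal (B * r ^ n) \<partial>K \<partial>poi lam)"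
      by (intro nn_integral_mono pt)
    also have "\<dots> = H (Suc n) x + ennreal (B * r ^ n)"
      by (simp add: H_Suc mean_step_def nn_integral_add)
    finally show ?thesis .
  qed
  have nonneg: "0 \<le> A * r ^ n" "0 \<le> B * r ^ n" for n
    using r \<theta> by (auto simp: A_def B_def)
  have step: "\<bar>enn2real (H (Suc n) x) - enn2real (H n x)\<bar> \<le> (A + B) * r ^ n" for n
  proof -
    obtain u v where uv: "H (Suc n) x = ennreal u" "H n x = ennreal v" "0 \<le> u" "0 \<le> v"
      using fin[of n] fin[of "Suc n"] by (metis enn2real_nonneg ennreal_enn2real)
    then have "u \<le> v + A * r ^ n" "v \<le> u + B * r ^ n"
      using up[of n] down[of n] nonneg[of n] by (auto simp flip: ennreal_plus)
    then show ?thesis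
      using uv nonneg[of n] by (auto simp: abs_le_iff algebra_simps)
  qed
  show ?thesis
    using convergent_if_geometric_increments[OF step r] by (simp add: H_def)
qed

section \<open>From sample paths to the iterated one-period means\<close>

lemma measurable_nat_binop:
  fixes X Y :: "'a \<Rightarrow> nat"
  assumes "X \<in> M \<rightarrow>\<^sub>M count_space UNIV" "Y \<in> M \<rightarrow>\<^sub>M count_space UNIV"
  shows "(\<lambda>\<omega>. f (X \<omega>) (Y \<omega>) :: nat) \<in> M \<rightarrow>\<^sub>M count_space UNIV"
proof (rule measurable_compose_countable[OF _ assms(1), where f = "\<lambda>x \<omega>. f x (Y \<omega>)"])
  show "(\<lambda>\<omega>. f x (Y \<omega>)) \<in> M \<rightarrow>\<^sub>M count_space UNIV" for x
    by (rule measurable_compose[OF assms(2)]) simp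
qed

text \<open>
  If \<open>Z\<close> does not look at coordinate \<open>t\<close>, then that coordinate may be replaced by an independent copy.
  This is the only form in which independence of the periods is used.
\<close>
lemma nn_integral_PiM_resample:
  fixes q :: "nat \<Rightarrow> 'a pmf" and Z :: "(nat \<Rightarrow> 'a) \<Rightarrow> nat" and h :: "nat \<Rightarrow> 'a \<Rightarrow> ennreal"
  defines "M \<equiv> \<Pi>\<^sub>M s\<in>UNIV. measure_pmf (q s)"
  assumes Z: "Z \<in> M \<rightarrow>\<^sub>M count_space UNIV" and indep: "\<And>\<omega> u. Z (fun_upd \<omega> t u) = Z \<omega>"
  shows "(\<integral>\<^sup>+\<omega>. h (Z \<omega>) (\<omega> t) \<partial>M) = (\<integral>\<^sup>+\<omega>. \<integral>\<^sup>+u. h (Z \<omega>) u \<partial>q t \<partial>M)"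
proof -
  define R where "R = (\<Pi>\<^sub>M s\<in>UNIV - {t}. measure_pmf (q s))"
  interpret R: prob_space R
    unfolding R_def by (intro prob_space_PiM measure_pmf.prob_space_axioms)
  have M_eq: "M = distr (measure_pmf (q t) \<Otimes>\<^sub>M R) M (\<lambda>(u, \<omega>). fun_upd \<omega> t u)"
    using distr_pair_PiM_eq_PiM[of "UNIV - {t}" "\<lambda>s. measure_pmf (q s)" t]
    by (simp add: M_def R_def measure_pmf.prob_space_axioms)
  have upd: "(\<lambda>(u, \<omega>). fun_upd \<omega> t u) \<in> measure_pmf (q t) \<Otimes>\<^sub>M R \<rightarrow>\<^sub>M M"
    unfolding M_def R_def
    using measurable_fun_upd[of UNIV "UNIV - {t}" t snd "measure_pmf (q t) \<Otimes>\<^sub>M (\<Pi>\<^sub>M s\<in>UNIV - {t}. measure_pmf (q s))"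
        "\<lambda>s. measure_pmf (q s)" fst]
    by (auto simp: case_prod_unfold)
  have split: "(\<integral>\<^sup>+\<omega>. F \<omega> \<partial>M) = (\<integral>\<^sup>+u. \<integral>\<^sup>+\<omega>. F (fun_upd \<omega> t u) \<partial>R \<partial>q t)"
    if F: "F \<in> borel_measurable M" for F
  proof -
    have "(\<integral>\<^sup>+\<omega>. F \<omega> \<partial>M) = (\<integral>\<^sup>+p. F ((\<lambda>(u, \<omega>). fun_upd \<omega> t u) p) \<partial>(measure_pmf (q t) \<Otimes>\<^sub>M R))"
      by (subst M_eq, rule nn_integral_distr) (use upd F in auto)
    also have "\<dots> = (\<integral>\<^sup>+u. \<integral>\<^sup>+\<omega>. F (fun_upd \<omega> t u) \<partial>R \<partial>q t)"
      by (subst R.nn_integral_fst[symmetric]) (use measurable_compose[OF upd F] in \<open>auto simp: case_prod_unfold\<close>)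
    finally show ?thesis .
  qed
  \<comment> \<open>\<open>R\<close> lives on functions that are \<open>undefined\<close> at \<open>t\<close>; overwriting this value leads back to
    \<open>M\<close>, where \<open>Z\<close> is known to be measurable.\<close>
  have ZR: "Z \<in> R \<rightarrow>\<^sub>M count_space UNIV"
  proof -
    have "(\<lambda>\<omega>. (undefined, \<omega>)) \<in> R \<rightarrow>\<^sub>M measure_pmf (q t) \<Otimes>\<^sub>M R"
      by simp
    from measurable_compose[OF measurable_compose[OF this upd] Z] show ?thesis
      by (simp add: indep)
  qed
  have coord: "(\<lambda>\<omega>. \<omega> t) \<in> M \<rightarrow>\<^sub>M measure_pmf (q t)"
    unfolding M_def by simp
  have m1: "(\<lambda>\<omega>. h (Z \<omega>) (\<omega> t)) \<in> borel_measurable M"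
    by (rule measurable_compose_countable[OF _ Z, where f = "\<lambda>z \<omega>. h z (\<omega> t)"],
        rule measurable_compose[OF coord]) simp
  have m2: "(\<lambda>\<omega>. \<integral>\<^sup>+u. h (Z \<omega>) u \<partial>q t) \<in> borel_measurable M"
    by (rule measurable_compose[OF Z]) simp
  interpret pair_sigma_finite "measure_pmf (q t)" R ..
  have m3: "(\<lambda>(u, \<omega>). h (Z \<omega>) u) \<in> borel_measurable (measure_pmf (q t) \<Otimes>\<^sub>M R)"
    unfolding case_prod_unfold
    by (rule measurable_compose_countable[OF _ measurable_compose[OF measurable_snd ZR],
          where f = "\<lambda>z p. h z (fst p)"], rule measurable_compose[OF measurable_fst]) simp
  have "(\<integral>\<^sup>+\<omega>. h (Z \<omega>) (\<omega> t) \<partial>M) = (\<integral>\<^sup>+u. \<integral>\<^sup>+\<omega>. h (Z \<omega>) u \<partial>R \<partial>q t)"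
    by (simp add: split[OF m1] indep)
  also have "\<dots> = (\<integral>\<^sup>+\<omega>. \<integral>\<^sup>+u. h (Z \<omega>) u \<partial>q t \<partial>R)"
    using Fubini'[OF m3] by simp
  also have "\<dots> = (\<integral>\<^sup>+\<omega>. \<integral>\<^sup>+u. h (Z \<omega>) u \<partial>q t \<partial>M)"
    by (simp add: split[OF m2] indep R.emeasure_space_1)
  finally show ?thesis .
qed

text \<open>
  Rate 0 after the cutoff merges the two cases of the express demand into one Poisson law.
\<close>
fun express_rate :: "real \<Rightarrow> real \<Rightarrow> real \<Rightarrow> policy \<Rightarrow> nat \<Rightarrow> real" where
  "express_rate lam Umin Umax (c, f) age =
     (if age \<le> c then express_share Umin Umax (f age) * lam else 0)"

lemma express_share_bounds:
  assumes "Umin < Umax" "fee \<in> {Umin..Umax}"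
  shows "0 \<le> express_share Umin Umax fee" "express_share Umin Umax fee \<le> 1"
  using assms by (auto simp: express_share_def)

lemma express_law_eq: "express_law lam Umin Umax \<pi> age = poi (express_rate lam Umin Umax \<pi> age)"
  by (cases \<pi>) (simp add: poi_def)

lemma express_rate_nonneg:
  assumes "0 < lam" "Umin < Umax" "\<pi> \<in> policies T Umin Umax"
  shows "0 \<le> express_rate lam Umin Umax \<pi> age"
  using assms express_share_bounds[OF assms(2)]
  by (cases \<pi>) (auto simp: policies_def PiE_def Pi_def)

text \<open>
  Whatever the policy, express and normal demand add up to a Poisson variable of rate \<open>lam\<close>. Hence the
  law of the total backlog does not depend on the policy.
\<close>
lemma nn_integral_total_law:
  assumes "0 < lam" "Umin < Umax" "\<pi> \<in> policies T Umin Umax"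
  shows "(\<integral>\<^sup>+e. \<integral>\<^sup>+n. h (e + n) \<partial>normal_law lam Umin Umax \<pi> age \<partial>express_law lam Umin Umax \<pi> age)
    = (\<integral>\<^sup>+d. h d \<partial>poi lam)"
proof (cases \<pi>)
  case (Pair c f)
  show ?thesis
  proof (cases "age \<le> c")
    case True
    define w where "w = express_share Umin Umax (f age)"
    have "0 \<le> w" "w \<le> 1"
      using True assms Pair express_share_bounds[OF assms(2)]
      by (auto simp: policies_def PiE_def Pi_def w_def)
    then have "(\<integral>\<^sup>+d. h d \<partial>poi (w * lam + (1 - w) * lam))
        = (\<integral>\<^sup>+e. \<integral>\<^sup>+n. h (e + n) \<partial>poi ((1 - w) * lam) \<partial>poi (w * lam))"
      using assms(1) by (intro nn_integral_poi_add) auto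
    also have "w * lam + (1 - w) * lam = lam"
      by (simp add: algebra_simps)
    finally show ?thesis
      using True by (simp add: Pair w_def)
  qed (simp add: Pair)
qed

context
  fixes T :: nat and lam Umin Umax :: real and K :: "nat pmf" and \<pi> :: policy and xS xh :: nat
  assumes lam: "0 < lam" and U: "Umin < Umax" and \<pi>: "\<pi> \<in> policies T Umin Umax"
begin

abbreviation "\<Omega> \<equiv> outcome_measure T lam Umin Umax K \<pi>"

lemma measurable_primitives:
  "express_demand t \<in> \<Omega> \<rightarrow>\<^sub>M count_space UNIV"
  "total_demand t \<in> \<Omega> \<rightarrow>\<^sub>M count_space UNIV"
  "capacity t \<in> \<Omega> \<rightarrow>\<^sub>M count_space UNIV"
proof -
  have coord: "(\<lambda>\<omega>. f (\<omega> t)) \<in> \<Omega> \<rightarrow>\<^sub>M count_space UNIV" for f :: "nat \<times> nat \<times> nat \<Rightarrow> nat"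
    unfolding outcome_measure_def
    by (rule measurable_compose[OF measurable_component_singleton]) auto
  show "express_demand t \<in> \<Omega> \<rightarrow>\<^sub>M count_space UNIV"
    "total_demand t \<in> \<Omega> \<rightarrow>\<^sub>M count_space UNIV"
    "capacity t \<in> \<Omega> \<rightarrow>\<^sub>M count_space UNIV"
    unfolding express_demand_def total_demand_def normal_demand_def capacity_def
    by (rule coord)+
qed

lemma measurable_backlog_update:
  assumes "Z \<in> \<Omega> \<rightarrow>\<^sub>M count_space UNIV" "D \<in> \<Omega> \<rightarrow>\<^sub>M count_space UNIV"
  shows "(\<lambda>\<omega>. Z \<omega> + D \<omega> - capacity t \<omega> :: nat) \<in> \<Omega> \<rightarrow>\<^sub>M count_space UNIV"
  by (intro measurable_nat_binop[where f = "(-)"] measurable_nat_binop[where f = "(+)"]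
      assms measurable_primitives)

lemma measurable_total_backlog: "total_backlog xS t \<in> \<Omega> \<rightarrow>\<^sub>M count_space UNIV"
proof (induction t)
  case (Suc t)
  then show ?case
    using measurable_backlog_update[OF _ measurable_primitives(2)] by (simp add: fun_eq_iff)
qed simp

lemma measurable_express_backlog: "express_backlog T xS xh t \<in> \<Omega> \<rightarrow>\<^sub>M count_space UNIV"
proof (induction t)
  case (Suc t)
  then show ?case
    using measurable_backlog_update[OF Suc measurable_primitives(1)]
      measurable_backlog_update[OF measurable_total_backlog measurable_primitives(2)]
    by (cases "t mod T \<noteq> T - 1") (simp_all add: fun_eq_iff)
qed simp

lemma measurable_cycle_backorders: "cycle_backorders T xS xh l \<in> \<Omega> \<rightarrow>\<^sub>M count_space UNIV"
  unfolding cycle_backorders_def Let_def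
  by (intro measurable_backlog_update measurable_express_backlog measurable_primitives)

lemma nn_integral_express_update:
  assumes "Z \<in> \<Omega> \<rightarrow>\<^sub>M count_space UNIV" "\<And>\<omega> u. Z (fun_upd \<omega> t u) = Z \<omega>"
  shows "(\<integral>\<^sup>+\<omega>. h (Z \<omega> + express_demand t \<omega> - capacity t \<omega>) \<partial>\<Omega>)
    = (\<integral>\<^sup>+\<omega>. mean_step K (express_rate lam Umin Umax \<pi> (t mod T)) h (Z \<omega>) \<partial>\<Omega>)"
  using nn_integral_PiM_resample[OF assms[unfolded outcome_measure_def],
      of "\<lambda>z u. h (z + fst u - snd (snd u))"]
  by (simp add: outcome_measure_def express_demand_def capacity_def nn_integral_pair_pmf'
      mean_step_def express_law_eq)

lemma nn_integral_total_update:
  assumes "Z \<in> \<Omega> \<rightarrow>\<^sub>M count_space UNIV" "\<And>\<omega> u. Z (fun_upd \<omega> t u) = Z \<omega>"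
  shows "(\<integral>\<^sup>+\<omega>. h (Z \<omega> + total_demand t \<omega> - capacity t \<omega>) \<partial>\<Omega>)
    = (\<integral>\<^sup>+\<omega>. mean_step K lam h (Z \<omega>) \<partial>\<Omega>)"
  using nn_integral_PiM_resample[OF assms[unfolded outcome_measure_def],
      of "\<lambda>z u. h (z + (fst u + fst (snd u)) - snd (snd u))"]
  by (simp add: outcome_measure_def express_demand_def normal_demand_def total_demand_def
      capacity_def nn_integral_pair_pmf' mean_step_def
      nn_integral_total_law[OF lam U \<pi>, where h = "\<lambda>d. \<integral>\<^sup>+k. h (_ + d - k) \<partial>K"])

lemma total_backlog_adapted: "t \<le> s \<Longrightarrow> total_backlog xS t (fun_upd \<omega> s u) = total_backlog xS t \<omega>"
  by (induction t)
    (auto simp: total_demand_def express_demand_def normal_demand_def capacity_def)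

lemma express_backlog_adapted:
  "t \<le> s \<Longrightarrow> express_backlog T xS xh t (fun_upd \<omega> s u) = express_backlog T xS xh t \<omega>"
  by (induction t)
    (auto simp: total_demand_def express_demand_def normal_demand_def capacity_def
      total_backlog_adapted)

lemma nn_integral_total_backlog:
  "(\<integral>\<^sup>+\<omega>. h (total_backlog xS t \<omega>) \<partial>\<Omega>) = mean_after K (replicate t lam) h xS"
proof (induction t arbitrary: h)
  case 0
  interpret prob_space \<Omega>
    unfolding outcome_measure_def by (intro prob_space_PiM measure_pmf.prob_space_axioms)
  show ?case
    by (simp add: emeasure_space_1)
next
  case (Suc t)
  have "(\<integral>\<^sup>+\<omega>. h (total_backlog xS (Suc t) \<omega>) \<partial>\<Omega>)
      = (\<integral>\<^sup>+\<omega>. mean_step K lam h (total_backlog xS t \<omega>) \<partial>\<Omega>)"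
    using nn_integral_total_update[OF measurable_total_backlog total_backlog_adapted[OF order_refl]]
    by simp
  also have "\<dots> = mean_after K (replicate t lam @ [lam]) h xS"
    unfolding Suc.IH by (simp del: foldr_replicate)
  also have "replicate t lam @ [lam] = replicate (Suc t) lam"
    by (simp add: replicate_append_same)
  finally show ?case .
qed

lemma express_backlog_cycle_start:
  assumes "1 \<le> T" "1 \<le> l"
  shows "express_backlog T xS xh (l * T) \<omega> = total_backlog xS (l * T) \<omega>"
proof -
  define t where "t = (l - 1) * T + (T - 1)"
  have t: "l * T = Suc t"
    using assms by (cases l) (auto simp: t_def)
  have "t mod T = T - 1"
    unfolding t_def mod_mult_self3 using assms(1) by simp
  then show ?thesis
    by (simp add: t)
qed

lemma nn_integral_express_backlog:
  assumes "1 \<le> T" "1 \<le> l" "j < T"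
  shows "(\<integral>\<^sup>+\<omega>. h (express_backlog T xS xh (l * T + j) \<omega>) \<partial>\<Omega>)
    = (\<integral>\<^sup>+\<omega>. mean_after K (map (express_rate lam Umin Umax \<pi>) [0..<j]) h (total_backlog xS (l * T) \<omega>) \<partial>\<Omega>)"
  using assms(3)
proof (induction j arbitrary: h)
  case 0
  show ?case
    by (simp add: express_backlog_cycle_start[OF assms(1,2)])
next
  case (Suc j)
  then have "(l * T + j) mod T = j" "j \<noteq> T - 1"
    by simp_all
  with Suc have "(\<integral>\<^sup>+\<omega>. h (express_backlog T xS xh (l * T + Suc j) \<omega>) \<partial>\<Omega>)
      = (\<integral>\<^sup>+\<omega>. mean_step K (express_rate lam Umin Umax \<pi> j) h (express_backlog T xS xh (l * T + j) \<omega>) \<partial>\<Omega>)"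
    using nn_integral_express_update[OF measurable_express_backlog express_backlog_adapted[OF order_refl],
        of h "l * T + j"] by simp
  then show ?case
    using Suc by simp
qed

text \<open>
  A cycle starts in the total backlog, which has evolved with rate \<open>lam\<close>, and then sees the express rates
  of the policy. The bound on \<open>l\<close> excludes the first cycle, which starts in \<open>xh\<close> instead.
\<close>
lemma nn_integral_cycle_backorders:
  assumes "1 \<le> T" "1 \<le> l"
  shows "(\<integral>\<^sup>+\<omega>. of_nat (cycle_backorders T xS xh l \<omega>) \<partial>\<Omega>)
    = mean_after K (replicate (l * T) lam)
        (mean_after K (map (express_rate lam Umin Umax \<pi>) [0..<T]) of_nat) xS"
proof -
  let ?t = "l * T + (T - 1)"
  have mod: "?t mod T = T - 1"
    unfolding mod_mult_self3 using assms(1) by simp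
  have "(\<integral>\<^sup>+\<omega>. of_nat (cycle_backorders T xS xh l \<omega>) \<partial>\<Omega>)
      = (\<integral>\<^sup>+\<omega>. mean_step K (express_rate lam Umin Umax \<pi> (T - 1)) of_nat (express_backlog T xS xh ?t \<omega>) \<partial>\<Omega>)"
    unfolding cycle_backorders_def Let_def
    using nn_integral_express_update[OF measurable_express_backlog express_backlog_adapted[OF order_refl],
        of of_nat ?t] unfolding mod .
  also have "\<dots> = (\<integral>\<^sup>+\<omega>. mean_after K (map (express_rate lam Umin Umax \<pi>) ([0..<T - 1] @ [T - 1])) of_nat
      (total_backlog xS (l * T) \<omega>) \<partial>\<Omega>)"
    using assms by (subst nn_integral_express_backlog) auto
  also have "[0..<T - 1] @ [T - 1] = [0..<T]"
    using assms(1) by (cases T) auto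
  finally show ?thesis
    by (simp add: nn_integral_total_backlog del: foldr_replicate)
qed

end

section \<open>Long-run means as functions of the policy\<close>

text \<open>
  The initial state \<open>x\<close> remains as a parameter, although in the stable case the limit is the
  mean of \<open>h\<close> in equilibrium: comparisons are made for one common initial state only.
\<close>
definition stationary_mean :: "nat pmf \<Rightarrow> real \<Rightarrow> (nat \<Rightarrow> ennreal) \<Rightarrow> nat \<Rightarrow> real" where
  "stationary_mean K lam h x = lim (\<lambda>n. enn2real (mean_after K (replicate n lam) h x))"

lemma tendsto_stationary_mean:
  assumes "0 < lam" "traffic_intensity lam K < 1" "nonexpansive h" "h x < \<top>"
  shows "(\<lambda>n. enn2real (mean_after K (replicate n lam) h x)) \<longlonglongrightarrow> stationary_mean K lam h x"
  using convergent_mean_after_replicate[OF assms] unfolding stationary_mean_def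
  by (rule convergent_LIMSEQ_iff[THEN iffD1])

text \<open>
  A pointwise inequality survives the transition operators, which are monotone and preserve
  constants, and the limit in time.
\<close>
lemma stationary_mean_le:
  assumes "0 < lam" "traffic_intensity lam K < 1"
    and "nonexpansive h" "h x < \<top>" "nonexpansive h'" "h' x < \<top>"
    and le: "\<And>y. h y \<le> h' y + ennreal c" and "0 \<le> c"
  shows "stationary_mean K lam h x \<le> stationary_mean K lam h' x + c"
proof (rule LIMSEQ_le)
  show "(\<lambda>n. enn2real (mean_after K (replicate n lam) h x)) \<longlonglongrightarrow> stationary_mean K lam h x"
    by (rule tendsto_stationary_mean) fact+
  show "(\<lambda>n. enn2real (mean_after K (replicate n lam) h' x) + c) \<longlonglongrightarrow> stationary_mean K lam h' x + c"
    by (intro tendsto_add tendsto_const tendsto_stationary_mean) fact+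
  have "enn2real (mean_after K (replicate n lam) h x) \<le> enn2real (mean_after K (replicate n lam) h' x) + c"
    for n
  proof -
    have fin: "mean_after K (replicate n lam) h' x < \<top>"
      using assms by (intro mean_after_finite) auto
    have "h \<le> (\<lambda>y. h' y + ennreal c)"
      using le by (auto intro: le_funI)
    from le_funD[OF mean_after_mono[OF this]]
    have "mean_after K (replicate n lam) h x \<le> mean_after K (replicate n lam) h' x + ennreal c"
      unfolding mean_after_add_const .
    then have "enn2real (mean_after K (replicate n lam) h x)
        \<le> enn2real (mean_after K (replicate n lam) h' x + ennreal c)"
      using fin by (intro enn2real_mono) (auto simp del: foldr_replicate)
    also have "\<dots> = enn2real (mean_after K (replicate n lam) h' x) + c"
      using fin \<open>0 \<le> c\<close> by (subst enn2real_plus) (auto simp del: foldr_replicate)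
    finally show ?thesis .
  qed
  then show "\<exists>N. \<forall>n\<ge>N. enn2real (mean_after K (replicate n lam) h x)
      \<le> enn2real (mean_after K (replicate n lam) h' x) + c"
    by blast
qed

lemma express_rates_eq:
  assumes "c < T"
  shows "map (express_rate lam Umin Umax (c, f)) [0..<T]
    = map (\<lambda>fee. express_share Umin Umax fee * lam) (map f [0..<Suc c]) @ replicate (T - Suc c) 0"
  using assms by (intro nth_equalityI) (auto simp: nth_append simp del: upt_Suc)

section \<open>Sorting the fees\<close>

definition sort_fees :: "policy \<Rightarrow> policy" where
  "sort_fees = (\<lambda>(c, f). (c, \<lambda>age\<in>{..c}. sort (map f [0..<Suc c]) ! age))"

lemma sort_fees_list: "map (snd (sort_fees (c, f))) [0..<Suc c] = sort (map f [0..<Suc c])"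
  by (intro nth_equalityI) (auto simp: sort_fees_def simp del: upt_Suc)

lemma sort_fees_policies:
  assumes "\<pi> \<in> policies T Umin Umax"
  shows "sort_fees \<pi> \<in> policies T Umin Umax"
proof -
  obtain c f where \<pi>: "\<pi> = (c, f)" by fastforce
  have "set (sort (map f [0..<Suc c])) \<subseteq> {Umin..Umax}"
    using assms by (auto simp: \<pi> policies_def simp del: upt_Suc)
  moreover have "sort (map f [0..<Suc c]) ! i \<in> set (sort (map f [0..<Suc c]))" if "i \<le> c" for i
    using that by (intro nth_mem) (simp del: upt_Suc)
  ultimately have "sort (map f [0..<Suc c]) ! i \<in> {Umin..Umax}" if "i \<le> c" for i
    using that by blast
  then show ?thesis
    using assms by (auto simp: \<pi> policies_def sort_fees_def simp del: upt_Suc atLeastAtMost_iff)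
qed

text \<open>
  The revenue is a sum over the multiset of fees.
\<close>
lemma expected_revenue_sort_fees:
  "expected_revenue lam Umin Umax (sort_fees \<pi>) = expected_revenue lam Umin Umax \<pi>"
proof -
  obtain c f where \<pi>: "\<pi> = (c, f)" by fastforce
  define earn where "earn fee = fee * express_share Umin Umax fee" for fee
  have rev: "expected_revenue lam Umin Umax (c, g) = lam * sum_mset (image_mset earn (mset (map g [0..<Suc c])))"
    for g
  proof -
    have "{..c} = set [0..<Suc c]" by auto
    then have "(\<Sum>age\<le>c. earn (g age)) = sum_list (map earn (map g [0..<Suc c]))"
      unfolding map_map by (simp only: sum.distinct_set_conv_list[OF distinct_upt] o_def)
    then show ?thesis
      unfolding mset_map[symmetric] sum_mset_sum_list by (simp add: earn_def del: upt_Suc)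
  qed
  have "fst (sort_fees (c, f)) = c"
    by (simp add: sort_fees_def)
  then have "expected_revenue lam Umin Umax (sort_fees (c, f))
      = lam * sum_mset (image_mset earn (mset (sort (map f [0..<Suc c]))))"
    using rev[of "snd (sort_fees (c, f))"] sort_fees_list[of c f] by (metis prod.collapse)
  then show ?thesis
    unfolding \<pi> rev mset_sort .
qed

context
  fixes T :: nat and lam Umin Umax :: real and K :: "nat pmf" and xS xh :: nat
  assumes T: "1 \<le> T" and lam: "0 < lam" and U: "Umin < Umax"
    and stable: "traffic_intensity lam K < 1"
begin

abbreviation backorders_from :: "policy \<Rightarrow> nat \<Rightarrow> ennreal" where
  "backorders_from \<pi> \<equiv> mean_after K (map (express_rate lam Umin Umax \<pi>) [0..<T]) of_nat"

lemma nonexpansive_backorders_from: "nonexpansive (backorders_from \<pi>)"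
  by (intro nonexpansive_mean_after nonexpansive_of_nat)

lemma backorders_from_finite:
  assumes "\<pi> \<in> policies T Umin Umax"
  shows "backorders_from \<pi> x < \<top>"
  using express_rate_nonneg[OF lam U assms]
  by (intro mean_after_finite nonexpansive_of_nat) (auto simp: of_nat_less_top)

text \<open>
  Expected backorders of single cycles already converge, hence so do their averages, with the same limit.
\<close>
lemma expected_backorders_eq_stationary_mean:
  assumes \<pi>: "\<pi> \<in> policies T Umin Umax"
  shows "expected_backorders T lam Umin Umax K xS xh \<pi> = stationary_mean K lam (backorders_from \<pi>) xS"
proof -
  let ?M = "outcome_measure T lam Umin Umax K \<pi>"
  let ?a = "\<lambda>n. enn2real (mean_after K (replicate n lam) (backorders_from \<pi>) xS)"
  let ?b = "\<lambda>l. \<integral>\<omega>. real (cycle_backorders T xS xh l \<omega>) \<partial>?M"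
  have "?a \<longlonglongrightarrow> stationary_mean K lam (backorders_from \<pi>) xS"
    by (intro tendsto_stationary_mean lam stable nonexpansive_backorders_from backorders_from_finite \<pi>)
  moreover have "filterlim (\<lambda>l. l * T) sequentially sequentially"
    using T by (intro filterlim_subseq) (simp add: strict_mono_def)
  ultimately have "(\<lambda>l. ?a (l * T)) \<longlonglongrightarrow> stationary_mean K lam (backorders_from \<pi>) xS"
    by (rule filterlim_compose)
  moreover have "?b l = ?a (l * T)" if "1 \<le> l" for l
  proof -
    have "(\<lambda>\<omega>. real (cycle_backorders T xS xh l \<omega>)) \<in> borel_measurable ?M"
      by (rule measurable_compose[OF measurable_cycle_backorders[OF lam U \<pi>]]) simp
    then have "?b l = enn2real (\<integral>\<^sup>+\<omega>. ennreal (real (cycle_backorders T xS xh l \<omega>)) \<partial>?M)"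
      by (intro integral_eq_nn_integral) auto
    then show ?thesis
      using nn_integral_cycle_backorders[OF lam U \<pi> T that]
      by (simp add: ennreal_of_nat_eq_real_of_nat)
  qed
  then have "\<forall>\<^sub>F l in sequentially. ?a (l * T) = ?b l"
    by (intro eventually_sequentiallyI[of 1]) (rule sym)
  ultimately have "?b \<longlonglongrightarrow> stationary_mean K lam (backorders_from \<pi>) xS"
    by (blast intro: Lim_transform_eventually)
  from tendsto_cesaro_mean[OF this] show ?thesis
    unfolding expected_backorders_def by (rule limI)
qed

text \<open>
  The express share falls with the fee, so that increasing fees are decreasing express rates, and it is
  best to have the large rates early in the cycle. The periods after the cutoff come last in either
  order; their effect is a monotone function of the backlog at the cutoff.
\<close>
lemma expected_backorders_sort_fees_le:
  assumes \<pi>: "\<pi> \<in> policies T Umin Umax"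
  shows "expected_backorders T lam Umin Umax K xS xh (sort_fees \<pi>)
    \<le> expected_backorders T lam Umin Umax K xS xh \<pi>"
proof -
  obtain c f where cf: "\<pi> = (c, f)" by fastforce
  define f' where "f' = snd (sort_fees (c, f))"
  have sort_cf: "sort_fees (c, f) = (c, f')"
    by (simp add: f'_def sort_fees_def)
  have c: "c < T" and fees: "\<And>age. age \<le> c \<Longrightarrow> f age \<in> {Umin..Umax}"
    using \<pi> by (auto simp: cf policies_def)
  let ?rate = "\<lambda>fee. express_share Umin Umax fee * lam"
  have "antimono ?rate"
    using U lam by (auto simp: antimono_def express_share_def divide_right_mono)
  moreover have "0 \<le> ?rate fee" if "fee \<in> set (map f [0..<Suc c])" for fee
    using that fees express_share_bounds(1)[OF U] lam by (auto simp del: upt_Suc)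
  ultimately have "mean_after K (map ?rate (sort (map f [0..<Suc c]))) h
      \<le> mean_after K (map ?rate (map f [0..<Suc c])) h" if "mono h" for h
    using that by (rule mean_after_sort_le)
  moreover have "mono (mean_after K (replicate (T - Suc c) 0) of_nat)"
    using nonexpansive_mean_after[OF nonexpansive_of_nat] unfolding nonexpansive_def by blast
  ultimately have "backorders_from (sort_fees \<pi>) \<le> backorders_from \<pi>"
    unfolding cf sort_cf express_rates_eq[OF c] foldr_append sort_fees_list[of c f, folded f'_def]
    by blast
  then have "stationary_mean K lam (backorders_from (sort_fees \<pi>)) xS
      \<le> stationary_mean K lam (backorders_from \<pi>) xS + 0"
    by (intro stationary_mean_le lam stable nonexpansive_backorders_from backorders_from_finite
        sort_fees_policies \<pi>) (auto simp: le_fun_def)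
  then show ?thesis
    by (simp add: expected_backorders_eq_stationary_mean sort_fees_policies \<pi>)
qed

text \<open>
  The bound is uniform in the backlog at the beginning of the cycle, and the law of this backlog is the
  same for both policies. Therefore it carries over to the long run.
\<close>
lemma expected_backorders_lipschitz:
  assumes \<pi>: "\<pi> \<in> policies T Umin Umax" and \<pi>': "\<pi>' \<in> policies T Umin Umax"
  shows "\<bar>expected_backorders T lam Umin Umax K xS xh \<pi> - expected_backorders T lam Umin Umax K xS xh \<pi>'\<bar>
    \<le> (\<Sum>age<T. \<bar>express_rate lam Umin Umax \<pi> age - express_rate lam Umin Umax \<pi>' age\<bar>)"
proof -
  let ?dist = "\<lambda>\<pi> \<pi>'. \<Sum>age<T. \<bar>express_rate lam Umin Umax \<pi> age - express_rate lam Umin Umax \<pi>' age\<bar>"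
  have one_sided: "expected_backorders T lam Umin Umax K xS xh \<pi>
      \<le> expected_backorders T lam Umin Umax K xS xh \<pi>' + ?dist \<pi> \<pi>'"
    if \<pi>: "\<pi> \<in> policies T Umin Umax" and \<pi>': "\<pi>' \<in> policies T Umin Umax" for \<pi> \<pi>'
  proof -
    let ?diff = "\<lambda>age. express_rate lam Umin Umax \<pi> age - express_rate lam Umin Umax \<pi>' age"
    have "backorders_from \<pi> x \<le> backorders_from \<pi>' x + ennreal (?dist \<pi> \<pi>')" for x
    proof -
      have "backorders_from \<pi> x \<le> backorders_from \<pi>' x + (\<Sum>age\<leftarrow>[0..<T]. ennreal (?diff age))"
        using express_rate_nonneg[OF lam U] \<pi> \<pi>'
        by (intro mean_after_rates_le nonexpansive_of_nat) auto
      also have "(\<Sum>age\<leftarrow>[0..<T]. ennreal (?diff age)) = (\<Sum>age<T. ennreal (?diff age))"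
        by (simp add: sum_list_distinct_conv_sum_set atLeast0LessThan)
      also have "\<dots> \<le> (\<Sum>age<T. ennreal \<bar>?diff age\<bar>)"
        by (intro sum_mono ennreal_leI) auto
      also have "\<dots> = ennreal (?dist \<pi> \<pi>')"
        by (simp add: sum_ennreal)
      finally show ?thesis
        by (simp add: add_left_mono)
    qed
    then show ?thesis
      unfolding expected_backorders_eq_stationary_mean[OF \<pi>] expected_backorders_eq_stationary_mean[OF \<pi>']
      by (intro stationary_mean_le lam stable nonexpansive_backorders_from backorders_from_finite
          \<pi> \<pi>' sum_nonneg) auto
  qed
  have "?dist \<pi>' \<pi> = ?dist \<pi> \<pi>'"
    by (intro sum.cong) auto
  then show ?thesis
    using one_sided[OF \<pi> \<pi>'] one_sided[OF \<pi>' \<pi>] by linarith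
qed

lemma continuous_on_expected_profit:
  assumes c: "c < T"
  shows "continuous_on ({..c} \<rightarrow>\<^sub>E {Umin..Umax})
    (\<lambda>f. expected_profit T lam \<beta> Umin Umax K xS xh (c, f))"
proof -
  let ?S = "{..c} \<rightarrow>\<^sub>E {Umin..Umax}"
  let ?B = "\<lambda>f. expected_backorders T lam Umin Umax K xS xh (c, f)"
  have pol: "(c, f) \<in> policies T Umin Umax" if "f \<in> ?S" for f
    using that c by (simp add: policies_def)
  have coord: "continuous_on S (\<lambda>f. f i)" for i and S :: "(nat \<Rightarrow> real) set"
    by (rule continuous_on_subset[OF continuous_on_product_coordinates]) simp
  have share: "continuous_on S (\<lambda>f. express_share Umin Umax (f i))" for i and S :: "(nat \<Rightarrow> real) set"
    unfolding express_share_def using U by (intro continuous_intros coord) auto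
  have rate: "continuous_on S (\<lambda>f. express_rate lam Umin Umax (c, f) i)"
    for i and S :: "(nat \<Rightarrow> real) set"
    by (cases "i \<le> c") (auto intro!: continuous_intros share)
  have "continuous_on ?S ?B"
    unfolding continuous_on_def
  proof
    fix g
    assume g: "g \<in> ?S"
    let ?D = "\<lambda>f. \<Sum>age<T. \<bar>express_rate lam Umin Umax (c, f) age - express_rate lam Umin Umax (c, g) age\<bar>"
    have "continuous_on ?S ?D"
      by (intro continuous_intros rate)
    then have "(?D \<longlongrightarrow> ?D g) (at g within ?S)"
      using g unfolding continuous_on_def by blast
    then have D: "(?D \<longlongrightarrow> 0) (at g within ?S)"
      by simp
    have "\<forall>\<^sub>F f in at g within ?S. norm (?B f - ?B g) \<le> ?D f"
      unfolding eventually_at_filter real_norm_def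
      by (intro always_eventually allI impI expected_backorders_lipschitz pol g)
    then show "(?B \<longlongrightarrow> ?B g) (at g within ?S)"
      by (rule LIM_zero_cancel[OF Lim_null_comparison[OF _ D]])
  qed
  then show ?thesis
    unfolding expected_profit_def expected_revenue.simps
    by (intro continuous_intros coord share)
qed

text \<open>
  For a fixed cutoff the fees range over a cube, which is compact in the product topology, and there
  are finitely many cutoffs.
\<close>
lemma exists_optimal_policy:
  "\<exists>\<pi>\<in>policies T Umin Umax. \<forall>\<pi>'\<in>policies T Umin Umax.
     expected_profit T lam \<beta> Umin Umax K xS xh \<pi>' \<le> expected_profit T lam \<beta> Umin Umax K xS xh \<pi>"
proof -
  let ?S = "\<lambda>c::nat. {..c} \<rightarrow>\<^sub>E {Umin..Umax}"
  let ?G = "expected_profit T lam \<beta> Umin Umax K xS xh"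
  have "\<exists>f\<in>?S c. \<forall>g\<in>?S c. ?G (c, g) \<le> ?G (c, f)" if "c < T" for c
  proof (rule continuous_attains_sup)
    \<comment> \<open>Extensional functions are a product over all indices with singletons outside \<open>{..c}\<close>; in this
      form Tychonoff's theorem applies to the topology of the function type.\<close>
    have "?S c = (\<Pi>\<^sub>E i\<in>UNIV. if i \<le> c then {Umin..Umax} else {undefined})"
      by (auto simp: PiE_iff extensional_def split: if_splits)
    moreover have "compact \<dots>"
    proof -
      have "compactin (product_topology (\<lambda>i. euclidean) UNIV)
          (\<Pi>\<^sub>E i\<in>UNIV. if i \<le> c then {Umin..Umax} else {undefined})"
        unfolding compactin_PiE by auto
      then show ?thesis
        by (simp add: euclidean_product_topology)
    qed
    ultimately show "compact (?S c)"
      by simp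
    show "?S c \<noteq> {}"
      using U by (auto simp: PiE_eq_empty_iff)
    show "continuous_on (?S c) (\<lambda>f. ?G (c, f))"
      using that by (rule continuous_on_expected_profit)
  qed
  then obtain best where best: "\<And>c. c < T \<Longrightarrow> best c \<in> ?S c"
    "\<And>c g. c < T \<Longrightarrow> g \<in> ?S c \<Longrightarrow> ?G (c, g) \<le> ?G (c, best c)"
    by metis
  have fin: "finite ((\<lambda>c. ?G (c, best c)) ` {..<T})" and ne: "(\<lambda>c. ?G (c, best c)) ` {..<T} \<noteq> {}"
    using T by (auto simp: lessThan_empty_iff)
  from Max_in[OF this] obtain c where c: "c < T"
    "Max ((\<lambda>c. ?G (c, best c)) ` {..<T}) = ?G (c, best c)"
    by auto
  show ?thesis
  proof (intro bexI ballI)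
    show "(c, best c) \<in> policies T Umin Umax"
      using c(1) best(1) by (simp add: policies_def)
    fix \<pi>' assume "\<pi>' \<in> policies T Umin Umax"
    then obtain c' g where c': "\<pi>' = (c', g)" "c' < T" "g \<in> ?S c'"
      by (auto simp: policies_def)
    then have "?G \<pi>' \<le> ?G (c', best c')"
      using best(2) by simp
    also have "\<dots> \<le> ?G (c, best c)"
      unfolding c(2)[symmetric] using c'(2) by (intro Max_ge fin) auto
    finally show "?G \<pi>' \<le> ?G (c, best c)" .
  qed
qed

end

section \<open>An optimal policy with increasing fees\<close>

theorem lemma7:
  fixes T :: nat and lam \<beta> Umin Umax :: real and K :: "nat pmf" and xS xh :: nat
  assumes "T \<ge> 1" and "lam > 0" and "\<beta> > 0"
    and "0 \<le> Umin" and "Umin < Umax"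
    and "set_pmf K = UNIV"
    and "traffic_intensity lam K < 1"
    and "xh \<le> xS"
  shows "\<exists>c f. (c, f) \<in> policies T Umin Umax
    \<and> (\<forall>\<pi>\<in>policies T Umin Umax.
          expected_profit T lam \<beta> Umin Umax K xS xh \<pi> \<le> expected_profit T lam \<beta> Umin Umax K xS xh (c, f))
    \<and> (\<forall>age\<in>{1..c}. f age \<ge> f (age - 1))"
proof -
  let ?G = "expected_profit T lam \<beta> Umin Umax K xS xh"
  obtain \<pi> where \<pi>: "\<pi> \<in> policies T Umin Umax" and opt: "\<And>\<pi>'. \<pi>' \<in> policies T Umin Umax \<Longrightarrow> ?G \<pi>' \<le> ?G \<pi>"
    using exists_optimal_policy[OF assms(1,2,5,7)] by blast
  obtain c f where sorted: "sort_fees \<pi> = (c, f)"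
    by fastforce
  have "?G \<pi> \<le> ?G (c, f)"
    using expected_backorders_sort_fees_le[OF assms(1,2,5,7) \<pi>] assms(3)
    unfolding expected_profit_def sorted[symmetric] expected_revenue_sort_fees by simp
  then have "?G \<pi>' \<le> ?G (c, f)" if "\<pi>' \<in> policies T Umin Umax" for \<pi>'
    using opt[OF that] by linarith
  moreover have "(c, f) \<in> policies T Umin Umax"
    using sort_fees_policies[OF \<pi>] by (simp add: sorted)
  moreover have "f (age - 1) \<le> f age" if "age \<in> {1..c}" for age
    using that sorted
    by (auto simp: sort_fees_def case_prod_unfold restrict_def simp del: upt_Suc intro!: sorted_nth_mono)
  ultimately show ?thesis
    by blast
qed

end
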